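(* Suppose there exist functions $\alpha:\mathbb{R}^{2m}\to\mathbb{R}$ and $\rho:\mathbb{R}^{2m}\times(0,\infty)\to\mathbb{R}$ such that $\Delta(x,h)=h^2\alpha(x)+h^2\rho(x,h)$ with $\lim_{h\to0}\rho(x,h)=0$ for every $x$, and suppose there exists $D:\mathbb{R}^{2m}\to\mathbb{R}$ such that $$\sup_{0<h\le1}\frac{|\Delta(x,h)|^2}{h^4}\le D(x),\qquad \int_{\mathbb{R}^{2m}}D(x)\,e^{-H(x)}\,dx<\infty .$$ Let $l>0$ be a constant and let the step-size be $h=l\cdot d^{-1/4}$. Then, in stationarity, i.e. when $X=(x_1,\dots,x_d)$ has density proportional to $\exp(-\sum_{i=1}^dH(x_i))$, $$\lim_{d\to\infty}\mathbb{E}[a(X,Y)]=2\,\Phi\bigl(-l^2\sqrt{\Sigma}/2\bigr)=:a(l),\qquad \Sigma=\int_{\mathbb{R}^{2m}}\alpha^2(x)\,\pi(dx),$$ where $\Phi$ is the standard normal distribution function.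
   Context: Fix an integer $m\ge1$, a symmetric positive definite $m\times m$ matrix $M$, a time $T>0$ and a differentiable $V:\mathbb{R}^m\to\mathbb{R}$ with $\int e^{-V}<\infty$. For $x=(q,p)\in\mathbb{R}^{2m}$ put $H(q,p)=\frac12\langle p,M^{-1}p\rangle+V(q)$, and let $\pi$ be the probability measure on $\mathbb{R}^{2m}$ with density proportional to $e^{-H}$. The leapfrog map with step $h>0$ is $\psi_h(q,p)=(q',p')$ with $$p_{1/2}=p-\tfrac h2\nabla V(q),\quad q'=q+hM^{-1}p_{1/2},\quad p'=p_{1/2}-\tfrac h2\nabla V(q'),$$ and $\psi_h^{(T)}:=\psi_h^{\lfloor T/h\rfloor}$ (composition power). The energy error is $\Delta(x,h):=H(\psi_h^{(T)}(x))-H(x)$. Hybrid Monte Carlo with $d$ particles: the state is $X=(x_1,\dots,x_d)\in(\mathbb{R}^{2m})^d$, $x_i=(q_i,p_i)$; the proposal is $Y=(\psi_h^{(T)}(x_1),\dots,\psi_h^{(T)}(x_d))$; and the acceptance probability is $$a(X,Y)=1\wedge\exp\Bigl(\sum_{i=1}^d[H(x_i)-H(\psi_h^{(T)}(x_i))]\Bigr).$$ *)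

theory Defs
  imports "HOL-Probability.Probability"
begin

type_synonym 'm phase = "(real ^ 'm) \<times> (real ^ 'm)"

definition symmetric_pos_def :: "real ^ 'm ^ 'm \<Rightarrow> bool" where
  "symmetric_pos_def M \<longleftrightarrow> transpose M = M \<and> (\<forall>v. v \<noteq> 0 \<longrightarrow> v \<bullet> (M *v v) > 0)"

definition gradient :: "('a::real_inner \<Rightarrow> real) \<Rightarrow> 'a \<Rightarrow> 'a" where
  "gradient V q = (THE g. GDERIV V q :> g)"

definition hamiltonian :: "real ^ 'm ^ 'm \<Rightarrow> (real ^ 'm \<Rightarrow> real) \<Rightarrow> 'm phase \<Rightarrow> real" where
  "hamiltonian M V x = (case x of (q, p) \<Rightarrow> 1 / 2 * (p \<bullet> (matrix_inv M *v p)) + V q)"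

definition leapfrog :: "real ^ 'm ^ 'm \<Rightarrow> (real ^ 'm \<Rightarrow> real) \<Rightarrow> real \<Rightarrow> 'm phase \<Rightarrow> 'm phase" where
  "leapfrog M V h x = (case x of (q, p) \<Rightarrow>
     let p_half = p - (h / 2) *\<^sub>R gradient V q;
         q' = q + h *\<^sub>R (matrix_inv M *v p_half);
         p' = p_half - (h / 2) *\<^sub>R gradient V q'
     in (q', p'))"

definition leapfrog_flow ::
    "real ^ 'm ^ 'm \<Rightarrow> (real ^ 'm \<Rightarrow> real) \<Rightarrow> real \<Rightarrow> real \<Rightarrow> 'm phase \<Rightarrow> 'm phase" where
  "leapfrog_flow M V T h = leapfrog M V h ^^ nat \<lfloor>T / h\<rfloor>"

definition energy_error ::
    "real ^ 'm ^ 'm \<Rightarrow> (real ^ 'm \<Rightarrow> real) \<Rightarrow> real \<Rightarrow> 'm phase \<Rightarrow> real \<Rightarrow> real" where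
  "energy_error M V T x h = hamiltonian M V (leapfrog_flow M V T h x) - hamiltonian M V x"

text \<open>The probability measure whose density with respect to \<open>N\<close> is proportional to
  \<open>exp (- E)\<close>; meaningful only if \<open>exp (- E)\<close> has a finite, nonzero integral.\<close>

definition gibbs_measure :: "'a measure \<Rightarrow> ('a \<Rightarrow> real) \<Rightarrow> 'a measure" where
  "gibbs_measure N E =
     density N (\<lambda>x. ennreal (exp (- E x) / (\<integral>y. exp (- E y) \<partial>N)))"

definition single_target ::
    "real ^ 'm ^ 'm \<Rightarrow> (real ^ 'm \<Rightarrow> real) \<Rightarrow> 'm phase measure" where
  "single_target M V = gibbs_measure lborel (hamiltonian M V)"

text \<open>A state of \<open>d\<close> particles is a function on the index set \<open>{..<d}\<close> (particles are numbered
  from \<open>0\<close>), extended by \<open>undefined\<close> as usual for \<open>PiM\<close>. The reference measure is Lebesgue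
  measure on the \<open>d\<close>-fold product of the phase space.\<close>

definition joint_target ::
    "real ^ 'm ^ 'm \<Rightarrow> (real ^ 'm \<Rightarrow> real) \<Rightarrow> nat \<Rightarrow> (nat \<Rightarrow> 'm phase) measure" where
  "joint_target M V d =
     gibbs_measure (\<Pi>\<^sub>M i\<in>{..<d}. lborel) (\<lambda>X. \<Sum>i<d. hamiltonian M V (X i))"

definition hmc_proposal ::
    "real ^ 'm ^ 'm \<Rightarrow> (real ^ 'm \<Rightarrow> real) \<Rightarrow> real \<Rightarrow> real \<Rightarrow> nat
       \<Rightarrow> (nat \<Rightarrow> 'm phase) \<Rightarrow> (nat \<Rightarrow> 'm phase)" where
  "hmc_proposal M V T h d X = (\<lambda>i\<in>{..<d}. leapfrog_flow M V T h (X i))"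

definition hmc_accept ::
    "real ^ 'm ^ 'm \<Rightarrow> (real ^ 'm \<Rightarrow> real) \<Rightarrow> nat
       \<Rightarrow> (nat \<Rightarrow> 'm phase) \<Rightarrow> (nat \<Rightarrow> 'm phase) \<Rightarrow> real" where
  "hmc_accept M V d X Y =
     min 1 (exp (\<Sum>i<d. hamiltonian M V (X i) - hamiltonian M V (Y i)))"

end

theory Submission
  imports Defs
begin

text \<open>
  Composed with the momentum flip, the leapfrog map is a Lebesgue-preserving involution. Hence the
  law of the single-particle energy error \<open>\<Delta>\<close> under the Gibbs measure satisfies
  \<open>E[v(- \<Delta>)] = E[v(\<Delta>) exp (- \<Delta>)]\<close>. For \<open>v(y) = sin (t y) / (1 + exp y)\<close> this symmetry gives
  \<open>E[sin (t \<Delta>)] = E[sin (t \<Delta>) tanh (\<Delta> / 2)]\<close>, so the mean of \<open>\<Delta>\<close>, although only its second moment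
  is controlled, is again a quadratic quantity. Dominated convergence then yields
  \<open>d (\<phi>(t) - 1) \<longlonglongrightarrow> \<i> t s\<^sup>2 / 2 - t\<^sup>2 s\<^sup>2 / 2\<close> with \<open>s = l\<^sup>2 \<surd>\<Sigma>\<close> for the characteristic function \<open>\<phi>\<close> of
  \<open>\<Delta>\<close>, so by Levy continuity the total energy error converges in law to the normal distribution
  with mean \<open>s\<^sup>2 / 2\<close> and variance \<open>s\<^sup>2\<close>. Against that law \<open>min 1 (exp (- y))\<close> integrates to \<open>2 \<Phi>(- s / 2)\<close>.
\<close>

section \<open>Limit of the acceptance probability under a reversal symmetry\<close>

text \<open>Since \<open>u\<close> tends to 0, the claim follows from writing
  \<open>n * g (u n)\<close> as the quotient \<open>g (u n) / (u n)^2\<close> times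
  \<open>(sqrt n * u n)^2\<close>. Filling in the quotient by \<open>c\<close> at 0 keeps this
  factorization valid when \<open>u n = 0\<close>, where both sides vanish by
  \<open>g0\<close>.\<close>

lemma scaled_quadratic_limit:
  fixes g :: "real \<Rightarrow> real"
  assumes g0: "g 0 = 0" and glim: "((\<lambda>x. g x / x\<^sup>2) \<longlongrightarrow> c) (at 0)"
    and conv: "(\<lambda>n. sqrt (real n) * u n) \<longlonglongrightarrow> a"
  shows "(\<lambda>n. real n * g (u n)) \<longlonglongrightarrow> c * a\<^sup>2"
proof -
  define G where "G x = (if x = 0 then c else g x / x\<^sup>2)" for x
  have "(G \<longlongrightarrow> c) (at 0)"
    using glim by (rule Lim_transform_eventually) (auto simp: G_def eventually_at_filter)
  then have "isCont G 0"
    by (simp add: isCont_def G_def)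
  moreover have "u \<longlonglongrightarrow> 0"
  proof (rule Lim_transform_eventually)
    show "(\<lambda>n. sqrt (inverse (real n)) * (sqrt (real n) * u n)) \<longlonglongrightarrow> 0"
      using tendsto_mult[OF tendsto_real_sqrt[OF lim_inverse_n] conv] by simp
    show "\<forall>\<^sub>F n in sequentially. sqrt (inverse (real n)) * (sqrt (real n) * u n) = u n"
      using eventually_gt_at_top[of 0] by eventually_elim (simp add: real_sqrt_inverse)
  qed
  ultimately have "(\<lambda>n. G (u n)) \<longlonglongrightarrow> c"
    using isCont_tendsto_compose[of 0 G u sequentially] by (simp add: G_def)
  then have "(\<lambda>n. G (u n) * (sqrt (real n) * u n)\<^sup>2) \<longlonglongrightarrow> c * a\<^sup>2"
    by (intro tendsto_intros conv)
  moreover have "G (u n) * (sqrt (real n) * u n)\<^sup>2 = real n * g (u n)" for n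
    by (auto simp: G_def g0 power_mult_distrib)
  ultimately show ?thesis by simp
qed

text \<open>Dominated convergence: the global quadratic bound on \<open>g\<close> turns the
  domination of \<open>n * (\<Delta> n x)^2\<close> by \<open>S\<close> into a domination of
  \<open>n * g (\<Delta> n x)\<close> by \<open>K * S\<close>. It serves below for
  \<open>1 - cos (t * x)\<close> and for \<open>sin (t * x) * tanh (x / 2)\<close>.\<close>

lemma scaled_quadratic_expectation_limit:
  fixes g :: "real \<Rightarrow> real" and \<Delta> :: "nat \<Rightarrow> 'a \<Rightarrow> real"
  assumes g0: "g 0 = 0" and glim: "((\<lambda>x. g x / x\<^sup>2) \<longlongrightarrow> c) (at 0)"
    and gK: "\<And>x. \<bar>g x\<bar> \<le> K * x\<^sup>2" and [measurable]: "g \<in> borel_measurable borel"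
    and [measurable]: "\<And>n. \<Delta> n \<in> borel_measurable P"
    and conv: "\<And>x. (\<lambda>n. sqrt (real n) * \<Delta> n x) \<longlonglongrightarrow> a x"
    and S: "integrable P S" and dom: "\<forall>\<^sub>F n in sequentially. \<forall>x. real n * (\<Delta> n x)\<^sup>2 \<le> S x"
  shows "(\<lambda>n. real n * (\<integral>x. g (\<Delta> n x) \<partial>P)) \<longlonglongrightarrow> c * (\<integral>x. (a x)\<^sup>2 \<partial>P)"
proof -
  have [measurable]: "a \<in> borel_measurable P"
    by (rule borel_measurable_LIMSEQ_real[OF conv]) measurable
  have K: "K \<ge> 0"
    using gK[of 1] by simp
  obtain N where N: "\<And>n x. n \<ge> N \<Longrightarrow> real n * (\<Delta> n x)\<^sup>2 \<le> S x"
    using dom by (auto simp: eventually_sequentially)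
  \<comment> \<open>The index is shifted by \<open>N\<close> because dominated convergence asks for
    the bound at every index, while \<open>dom\<close> gives it only eventually.\<close>
  have "(\<lambda>n. \<integral>x. real (n + N) * g (\<Delta> (n + N) x) \<partial>P) \<longlonglongrightarrow> (\<integral>x. c * (a x)\<^sup>2 \<partial>P)"
  proof (rule integral_dominated_convergence[where w = "\<lambda>x. K * S x"])
    show "AE x in P. (\<lambda>n. real (n + N) * g (\<Delta> (n + N) x)) \<longlonglongrightarrow> c * (a x)\<^sup>2"
      by (rule AE_I2) (rule LIMSEQ_ignore_initial_segment[OF scaled_quadratic_limit[OF g0 glim conv]])
    show "AE x in P. norm (real (n + N) * g (\<Delta> (n + N) x)) \<le> K * S x" for n
    proof (rule AE_I2)
      fix x
      have "norm (real (n + N) * g (\<Delta> (n + N) x)) \<le> real (n + N) * (K * (\<Delta> (n + N) x)\<^sup>2)"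
        by (simp add: abs_mult mult_left_mono gK del: of_nat_add)
      also have "\<dots> \<le> K * S x"
        using mult_left_mono[OF N[of "n + N" x] K] by (simp add: mult_ac)
      finally show "norm (real (n + N) * g (\<Delta> (n + N) x)) \<le> K * S x" .
    qed
  qed (use S in auto)
  then show ?thesis
    unfolding integral_mult_right_zero by (rule LIMSEQ_offset)
qed

lemma abs_tanh_le: "\<bar>tanh x\<bar> \<le> \<bar>x\<bar>" for x :: real
proof -
  have "norm (tanh x - tanh 0) \<le> 1 * norm (x - 0)"
  proof (rule field_differentiable_bound[where S = UNIV])
    show "(tanh has_field_derivative 1 - (tanh z)\<^sup>2) (at z within UNIV)" for z :: real
      by (auto intro!: derivative_eq_intros)
    show "norm (1 - (tanh z)\<^sup>2) \<le> 1" for z :: real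
    proof -
      have "\<bar>tanh z\<bar> \<le> 1"
        using tanh_real_bounds[of z] by auto
      then have "(tanh z)\<^sup>2 \<le> 1"
        by (simp add: abs_square_le_1)
      then show ?thesis
        by simp
    qed
  qed auto
  then show ?thesis
    by simp
qed

section \<open>The reversal identity for sine expectations\<close>

text \<open>The weight \<open>1 / (1 + exp y)\<close> is chosen so that the bounded function
  \<open>v\<close> satisfies \<open>exp (- y) * v (- y) = - v y\<close>. By \<open>rev\<close> the
  mean of \<open>v (X x)\<close> then equals its own negative, hence is 0. The gain is that a
  quantity of first order in \<open>X\<close> is replaced by one of second order.\<close>

lemma involution_sin_identity:
  fixes X :: "'a \<Rightarrow> real"
  assumes "prob_space P" and [measurable]: "X \<in> borel_measurable P"
    and rev: "distr P borel (\<lambda>x. - X x) = density (distr P borel X) (\<lambda>y. ennreal (exp (- y)))"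
  shows "(\<integral>x. sin (t * X x) \<partial>P) = (\<integral>x. sin (t * X x) * tanh (X x / 2) \<partial>P)"
proof -
  interpret prob_space P by fact
  define v :: "real \<Rightarrow> real" where "v y = sin (t * y) / (1 + exp y)" for y
  have [measurable]: "v \<in> borel_measurable borel"
    unfolding v_def by measurable
  have vb: "\<bar>v y\<bar> \<le> 1" for y
  proof -
    have "\<bar>sin (t * y)\<bar> \<le> 1 + exp y" "1 + exp y > 0"
      using abs_sin_le_one[of "t * y"] exp_gt_zero[of y] by linarith+
    then show ?thesis
      by (simp add: v_def abs_divide divide_le_eq)
  qed
  have v_odd: "exp (- y) * v (- y) = - v y" for y
  proof -
    have "1 + exp y \<noteq> 0"
      using exp_gt_zero[of y] by linarith
    then show ?thesis
      by (simp add: v_def exp_minus field_simps)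
  qed
  have "(\<integral>x. v (X x) \<partial>P) = (\<integral>y. v (- y) \<partial>distr P borel (\<lambda>x. - X x))"
    by (subst integral_distr) simp_all
  also have "\<dots> = (\<integral>y. exp (- y) * v (- y) \<partial>distr P borel X)"
    unfolding rev by (subst integral_density) simp_all
  also have "\<dots> = - (\<integral>x. v (X x) \<partial>P)"
    by (simp add: v_odd integral_distr)
  finally have v0: "(\<integral>x. v (X x) \<partial>P) = 0"
    by simp
  \<comment> \<open>This rests on \<open>1 - tanh (y / 2) = 2 / (1 + exp y)\<close>, so the two sine
    expressions differ exactly by \<open>2 * v y\<close>.\<close>
  have eq: "sin (t * y) = sin (t * y) * tanh (y / 2) + 2 * v y" for y :: real
  proof -
    have pos: "exp y > 0" "1 + exp y > 0"
      using exp_gt_zero[of y] by linarith+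
    have "tanh (y / 2) = (1 - 1 / exp y) / (1 + 1 / exp y)"
      by (simp add: tanh_real_altdef exp_minus inverse_eq_divide)
    also have "\<dots> = (exp y - 1) / (1 + exp y)"
      using pos by (simp add: divide_simps)
    finally have "tanh (y / 2) + 2 / (1 + exp y) = 1"
      using pos by (simp add: divide_simps)
    then have "sin (t * y) * (tanh (y / 2) + 2 / (1 + exp y)) = sin (t * y)"
      by simp
    then show ?thesis
      by (simp add: v_def algebra_simps)
  qed
  have "integrable P (\<lambda>x. v (X x))"
    by (rule integrable_const_bound[where B = 1]) (auto simp: vb)
  moreover have "integrable P (\<lambda>x. sin (t * X x) * tanh (X x / 2))"
  proof (rule integrable_const_bound[where B = 1])
    have "\<bar>sin (t * X x)\<bar> * \<bar>tanh (X x / 2)\<bar> \<le> 1" for x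
      using tanh_real_bounds[of "X x / 2"] by (intro mult_le_one) auto
    then show "AE x in P. norm (sin (t * X x) * tanh (X x / 2)) \<le> 1"
      by (simp add: abs_mult)
  qed (simp add: tanh_real_altdef)
  ultimately show ?thesis
    by (subst eq) (simp add: v0)
qed

section \<open>Powers of characteristic functions\<close>

text \<open>Compare \<open>\<phi> n\<close> with \<open>e n = exp (c / n)\<close>, whose
  \<open>n\<close>-th power is \<open>exp c\<close> for \<open>n > 0\<close>. For numbers in the
  closed unit disc, \<open>n\<close>-th powers differ by at most \<open>n\<close> times the
  difference of the bases; \<open>Re c \<le> 0\<close> keeps \<open>e n\<close> in the disc. Both
  bases have the same first-order expansion, so this bound tends to 0, and no complex logarithm is
  involved.\<close>

lemma tendsto_power_exp_complex:
  fixes \<phi> :: "nat \<Rightarrow> complex"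
  assumes lim: "(\<lambda>n. of_nat n * (\<phi> n - 1)) \<longlonglongrightarrow> c" and le1: "\<And>n. norm (\<phi> n) \<le> 1" and c: "Re c \<le> 0"
  shows "(\<lambda>n. \<phi> n ^ n) \<longlonglongrightarrow> exp c"
proof -
  define e where "e n = exp (c / of_nat n)" for n
  \<comment> \<open>The derivative of \<open>exp (c * h)\<close> at 0, sampled at
    \<open>h = 1 / n\<close>, gives the first-order expansion of \<open>e n\<close>.\<close>
  have "((\<lambda>h. (exp (c * h) - 1) / h) \<longlongrightarrow> c) (at 0)"
  proof -
    have "((\<lambda>h. exp (c * h)) has_field_derivative c) (at 0)"
      by (auto intro!: derivative_eq_intros)
    then show ?thesis
      by (simp add: DERIV_def)
  qed
  moreover have "filterlim (\<lambda>n. inverse (of_nat n) :: complex) (at 0) sequentially"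
    unfolding filterlim_at
    by (intro conjI tendsto_inverse_0_at_top[THEN tendsto_of_real] lim_inverse_n)
       (auto intro: eventually_mono[OF eventually_gt_at_top[of 0]])
  ultimately have "(\<lambda>n. (exp (c * inverse (of_nat n)) - 1) / inverse (of_nat n)) \<longlonglongrightarrow> c"
    by (rule filterlim_compose)
  then have "(\<lambda>n. of_nat n * (e n - 1)) \<longlonglongrightarrow> c"
    by (simp add: e_def field_simps)
  from tendsto_diff[OF lim this]
  have *: "(\<lambda>n. norm (of_nat n * (\<phi> n - e n))) \<longlonglongrightarrow> 0"
    by (intro tendsto_norm_zero) (simp add: algebra_simps)
  have "norm (\<phi> n ^ n - e n ^ n) \<le> norm (of_nat n * (\<phi> n - e n))" for n
  proof -
    have "norm (e n) \<le> 1"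
      using c by (simp add: e_def Re_divide_of_nat divide_nonpos_nonneg)
    then show ?thesis
      using norm_power_diff[OF le1, of "e n" n n] by (simp add: norm_mult)
  qed
  then have "(\<lambda>n. \<phi> n ^ n - e n ^ n) \<longlonglongrightarrow> 0"
    by (intro Lim_null_comparison[OF _ *]) auto
  moreover have "(\<lambda>n. e n ^ n) \<longlonglongrightarrow> exp c"
    by (rule tendsto_eventually, rule eventually_mono[OF eventually_gt_at_top[of 0]])
       (simp add: e_def flip: exp_of_nat_mult)
  ultimately show ?thesis
    using tendsto_add by fastforce
qed

section \<open>Gaussian computations\<close>

lemma cdf_std_normal_reflect:
  "measure std_normal_distribution {x<..} = cdf std_normal_distribution (- x)"
proof -
  have "emeasure std_normal_distribution {x<..} = (\<integral>\<^sup>+y. ennreal (std_normal_density y) * indicator {x<..} y \<partial>lborel)"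
    by (simp add: emeasure_density)
  also have "\<dots> = (\<integral>\<^sup>+y. ennreal (std_normal_density (0 + (-1) * y)) * indicator {x<..} (0 + (-1) * y) \<partial>lborel)"
    by (subst nn_integral_real_affine[of _ "-1" 0]) simp_all
  \<comment> \<open>The reflected half-line is open at \<open>- x\<close>, the target one is closed;
    the endpoint is a Lebesgue null set.\<close>
  also have "\<dots> = (\<integral>\<^sup>+y. ennreal (std_normal_density y) * indicator {..- x} y \<partial>lborel)"
    using AE_lborel_singleton[of "-x"]
    by (intro nn_integral_cong_AE) (auto simp: std_normal_density_def indicator_def elim!: eventually_mono)
  also have "\<dots> = emeasure std_normal_distribution {..- x}"
    by (simp add: emeasure_density)
  finally show ?thesis
    by (simp add: cdf_def measure_def)
qed

text \<open>The exponent changes sign at \<open>z = - s / 2\<close>. To the left the minimum is 1;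
  to the right, completing the square turns the weighted density into
  \<open>std_normal_density (s + z)\<close>. Both pieces are therefore standard normal tails beyond
  distance \<open>s / 2\<close>, equal by reflection.\<close>

lemma expectation_min_exp_normal:
  assumes s: "s \<ge> 0"
  shows "(\<integral>z. min 1 (exp (- (s\<^sup>2 / 2 + s * z))) \<partial>std_normal_distribution)
           = 2 * cdf std_normal_distribution (- s / 2)"
proof -
  interpret N: real_distribution std_normal_distribution
    by (rule real_dist_normal_dist)
  \<comment> \<open>The shape \<open>s + 1 * z\<close> is that of an affine substitution, which
    later shifts the second summand onto \<open>{s / 2<..}\<close>.\<close>
  have "(\<integral>\<^sup>+z. ennreal (min 1 (exp (- (s\<^sup>2 / 2 + s * z)))) \<partial>std_normal_distribution)
      = (\<integral>\<^sup>+z. ennreal (std_normal_density z) * indicator {..- s / 2} z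
           + ennreal (std_normal_density (s + 1 * z)) * indicator {s / 2<..} (s + 1 * z) \<partial>lborel)"
  proof (subst nn_integral_density, simp, simp, intro nn_integral_cong)
    fix z :: real
    have e: "std_normal_density z * exp (- (s\<^sup>2 / 2 + s * z)) = std_normal_density (s + z)"
      by (simp add: std_normal_density_def mult_exp_exp power2_eq_square field_simps)
    have le: "s\<^sup>2 / 2 + s * z \<le> 0" if "z \<le> - s / 2"
      using mult_left_mono[OF that s] by (simp add: power2_eq_square)
    have ge: "s\<^sup>2 / 2 + s * z \<ge> 0" if "z > - s / 2"
      using mult_left_mono[OF less_imp_le[OF that] s] by (simp add: power2_eq_square)
    show "ennreal (std_normal_density z) * ennreal (min 1 (exp (- (s\<^sup>2 / 2 + s * z))))
        = ennreal (std_normal_density z) * indicator {..- s / 2} z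
           + ennreal (std_normal_density (s + 1 * z)) * indicator {s / 2<..} (s + 1 * z)"
    proof (cases "z \<le> - s / 2")
      case True
      then have "min 1 (exp (- (s\<^sup>2 / 2 + s * z))) = 1"
        using le by (simp add: min_def)
      then show ?thesis using True by simp
    next
      case False
      then have "min 1 (exp (- (s\<^sup>2 / 2 + s * z))) = exp (- (s\<^sup>2 / 2 + s * z))"
        using ge by (simp add: min_def)
      then have "ennreal (std_normal_density z) * ennreal (min 1 (exp (- (s\<^sup>2 / 2 + s * z))))
          = ennreal (std_normal_density (s + z))"
        using e by (metis ennreal_mult' normal_density_nonneg)
      then show ?thesis using False
        by simp
    qed
  qed
  also have "\<dots> = (\<integral>\<^sup>+z. ennreal (std_normal_density z) * indicator {..- s / 2} z \<partial>lborel)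
      + (\<integral>\<^sup>+z. ennreal (std_normal_density z) * indicator {s / 2<..} z \<partial>lborel)"
    by (subst nn_integral_add)
       (simp_all add: nn_integral_real_affine[of "\<lambda>z. ennreal (std_normal_density z) * indicator {s / 2<..} z" 1 s])
  also have "\<dots> = emeasure std_normal_distribution {..- s / 2} + emeasure std_normal_distribution {s / 2<..}"
    by (simp add: emeasure_density)
  also have "\<dots> = ennreal (2 * cdf std_normal_distribution (- s / 2))"
    using cdf_std_normal_reflect[of "s / 2"]
    by (simp add: N.emeasure_eq_measure cdf_def flip: ennreal_plus)
  finally show ?thesis
    by (subst integral_eq_nn_integral) (auto simp: cdf_def)
qed

section \<open>Central limit theorem for the total energy error\<close>

text \<open>The sum is a row of a triangular array of independent, identically distributed terms.
  Its variance is governed by \<open>conv\<close> and \<open>dom\<close>, while its mean is fixed by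
  \<open>rev\<close> as half the limiting variance. All dynamics is abstracted away: the leapfrog
  map enters only through these hypotheses.\<close>

lemma metropolis_acceptance_limit:
  fixes \<Delta> :: "nat \<Rightarrow> 'a \<Rightarrow> real"
  assumes "prob_space P" and [measurable]: "\<And>n. \<Delta> n \<in> borel_measurable P"
    and rev: "\<And>n. distr P borel (\<lambda>x. - \<Delta> n x) = density (distr P borel (\<Delta> n)) (\<lambda>y. ennreal (exp (- y)))"
    and conv: "\<And>x. (\<lambda>n. sqrt (real n) * \<Delta> n x) \<longlonglongrightarrow> a x"
    and S: "integrable P S" and dom: "\<forall>\<^sub>F n in sequentially. \<forall>x. real n * (\<Delta> n x)\<^sup>2 \<le> S x"
  shows "(\<lambda>n. \<integral>X. min 1 (exp (- (\<Sum>i<n. \<Delta> n (X i)))) \<partial>(\<Pi>\<^sub>M i\<in>{..<n}. P))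
           \<longlonglongrightarrow> 2 * cdf std_normal_distribution (- sqrt (\<integral>x. (a x)\<^sup>2 \<partial>P) / 2)"
proof -
  interpret prob_space P by fact
  interpret product_sigma_finite "\<lambda>_ :: nat. P" ..
  interpret N: real_distribution std_normal_distribution
    by (rule real_dist_normal_dist)
  define s where "s = sqrt (\<integral>x. (a x)\<^sup>2 \<partial>P)"
  have s0: "s \<ge> 0" and s2: "(\<integral>x. (a x)\<^sup>2 \<partial>P) = s\<^sup>2"
    by (simp_all add: s_def)
  define \<mu> where "\<mu> n = distr (\<Pi>\<^sub>M i\<in>{..<n}. P) borel (\<lambda>X. \<Sum>i<n. \<Delta> n (X i))" for n
  \<comment> \<open>The candidate limit is an affine image of the standard normal law, so the
    degenerate case \<open>s = 0\<close>, a point mass at 0, needs no separate treatment.\<close>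
  define \<nu> where "\<nu> = distr std_normal_distribution borel (\<lambda>z. s\<^sup>2 / 2 + s * z)"
  have PiM: "prob_space (\<Pi>\<^sub>M i\<in>{..<n}. P)" for n :: nat
    by (intro prob_space_PiM) unfold_locales
  have \<mu>_real: "real_distribution (\<mu> n)" for n
    unfolding \<mu>_def by (intro prob_space.real_distribution_distr[OF PiM]) measurable
  have \<nu>_real: "real_distribution \<nu>"
    unfolding \<nu>_def by (intro N.real_distribution_distr) measurable
  have "(\<lambda>n. char (\<mu> n) t) \<longlonglongrightarrow> char \<nu> t" for t
  proof -
    define \<phi> where "\<phi> n = (\<integral>x. iexp (t * \<Delta> n x) \<partial>P)" for n
    have \<phi>_int: "integrable P (\<lambda>x. iexp (t * \<Delta> n x))" for n
      by (rule integrable_iexp) measurable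
    have char_\<mu>: "char (\<mu> n) t = \<phi> n ^ n" for n
    proof -
      have "char (\<mu> n) t = (\<integral>X. iexp (t * (\<Sum>i<n. \<Delta> n (X i))) \<partial>(\<Pi>\<^sub>M i\<in>{..<n}. P))"
        unfolding char_def \<mu>_def by (subst integral_distr) simp_all
      also have "\<dots> = (\<integral>X. (\<Prod>i<n. iexp (t * \<Delta> n (X i))) \<partial>(\<Pi>\<^sub>M i\<in>{..<n}. P))"
        by (simp add: sum_distrib_left exp_sum)
      also have "\<dots> = \<phi> n ^ n"
        using \<phi>_int by (subst product_integral_prod) (simp_all add: \<phi>_def)
      finally show ?thesis .
    qed
    have char_\<nu>: "char \<nu> t = exp (Complex (- (t\<^sup>2 * s\<^sup>2 / 2)) (t * s\<^sup>2 / 2))"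
    proof -
      have "char \<nu> t = (\<integral>z. iexp (t * (s\<^sup>2 / 2 + s * z)) \<partial>std_normal_distribution)"
        unfolding char_def \<nu>_def by (subst integral_distr) simp_all
      also have "\<dots> = (\<integral>z. iexp (t * s\<^sup>2 / 2) * iexp ((t * s) * z) \<partial>std_normal_distribution)"
        by (simp add: algebra_simps flip: exp_add)
      also have "\<dots> = iexp (t * s\<^sup>2 / 2) * char std_normal_distribution (t * s)"
        unfolding char_def by simp
      also have "\<dots> = exp (Complex (- (t\<^sup>2 * s\<^sup>2 / 2)) (t * s\<^sup>2 / 2))"
        by (simp add: char_std_normal_distribution Complex_eq power_mult_distrib algebra_simps
            flip: exp_of_real exp_add)
      finally show ?thesis .
    qed
    have Re: "Re (\<phi> n) = (\<integral>x. cos (t * \<Delta> n x) \<partial>P)" and Im: "Im (\<phi> n) = (\<integral>x. sin (t * \<Delta> n x) \<partial>P)" for n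
      unfolding \<phi>_def integral_Re[OF \<phi>_int, symmetric] integral_Im[OF \<phi>_int, symmetric]
      by (simp_all add: Re_exp Im_exp)
    \<comment> \<open>The two global quadratic bounds, from the half-angle formula and from
      \<open>abs_tanh_le\<close>, are what the domination in
      \<open>scaled_quadratic_expectation_limit\<close> requires.\<close>
    have cos_bound: "\<bar>1 - cos (t * x)\<bar> \<le> t\<^sup>2 / 2 * x\<^sup>2" for x :: real
    proof -
      have "1 - cos (t * x) = 2 * (sin (t * x / 2))\<^sup>2"
        using cos_double_sin[of "t * x / 2"] by simp
      moreover have "(sin (t * x / 2))\<^sup>2 \<le> (t * x / 2)\<^sup>2"
        using abs_sin_x_le_abs_x[of "t * x / 2"] by (simp only: abs_le_square_iff)
      ultimately show ?thesis
        by (simp add: power_mult_distrib power_divide)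
    qed
    have sin_bound: "\<bar>sin (t * x) * tanh (x / 2)\<bar> \<le> \<bar>t\<bar> / 2 * x\<^sup>2" for x :: real
    proof -
      have "\<bar>sin (t * x)\<bar> * \<bar>tanh (x / 2)\<bar> \<le> \<bar>t * x\<bar> * \<bar>x / 2\<bar>"
        by (intro mult_mono abs_sin_x_le_abs_x abs_tanh_le) auto
      then show ?thesis
        by (simp add: abs_mult power2_eq_square)
    qed
    have sin_lim: "((\<lambda>x. sin (c * x) / x) \<longlongrightarrow> c) (at 0)" for c :: real
    proof -
      have "((\<lambda>x. sin (c * x)) has_field_derivative c) (at 0)"
        by (auto intro!: derivative_eq_intros)
      then show ?thesis
        by (simp add: DERIV_def)
    qed
    have tanh_lim: "((\<lambda>x :: real. tanh (x / 2) / x) \<longlongrightarrow> 1 / 2) (at 0)"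
    proof -
      have "((\<lambda>x :: real. tanh (x / 2)) has_field_derivative 1 / 2) (at 0)"
        by (auto intro!: derivative_eq_intros)
      then show ?thesis
        by (simp add: DERIV_def)
    qed
    have "((\<lambda>x. 2 * (sin (t / 2 * x) / x)\<^sup>2) \<longlongrightarrow> 2 * (t / 2)\<^sup>2) (at 0)"
      by (intro tendsto_intros sin_lim)
    moreover have "(\<lambda>x. 2 * (sin (t / 2 * x) / x)\<^sup>2) = (\<lambda>x. (1 - cos (t * x)) / x\<^sup>2)"
    proof
      show "2 * (sin (t / 2 * x) / x)\<^sup>2 = (1 - cos (t * x)) / x\<^sup>2" for x
        using cos_double_sin[of "t * x / 2"] by (simp add: power_divide)
    qed
    moreover have "2 * (t / 2)\<^sup>2 = t\<^sup>2 / 2"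
      by (simp add: power_divide)
    ultimately have cos_lim: "((\<lambda>x. (1 - cos (t * x)) / x\<^sup>2) \<longlongrightarrow> t\<^sup>2 / 2) (at 0)"
      by simp
    have sin_tanh_lim: "((\<lambda>x. sin (t * x) * tanh (x / 2) / x\<^sup>2) \<longlongrightarrow> t / 2) (at 0)"
      using tendsto_mult[OF sin_lim[of t] tanh_lim] by (simp add: power2_eq_square)
    have "(\<lambda>n. real n * (\<integral>x. 1 - cos (t * \<Delta> n x) \<partial>P)) \<longlonglongrightarrow> t\<^sup>2 / 2 * s\<^sup>2"
      unfolding s2[symmetric]
      by (rule scaled_quadratic_expectation_limit[OF _ cos_lim cos_bound _ _ conv S dom]) simp_all
    moreover have "(\<integral>x. 1 - cos (t * \<Delta> n x) \<partial>P) = 1 - Re (\<phi> n)" for n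
    proof -
      have "integrable P (\<lambda>x. cos (t * \<Delta> n x))"
        by (rule integrable_const_bound[where B = 1]) auto
      then show ?thesis
        by (simp add: Re prob_space)
    qed
    ultimately have "(\<lambda>n. - (real n * (1 - Re (\<phi> n)))) \<longlonglongrightarrow> - (t\<^sup>2 / 2 * s\<^sup>2)"
      by (intro tendsto_minus) simp
    then have Re_lim: "(\<lambda>n. real n * (Re (\<phi> n) - 1)) \<longlonglongrightarrow> - (t\<^sup>2 * s\<^sup>2 / 2)"
      by (simp add: algebra_simps)
    \<comment> \<open>The imaginary part of \<open>\<phi> n\<close> is a mean of sines, of first
      order in \<open>\<Delta> n\<close>. The reversal identity supplies the extra factor
      \<open>tanh\<close>, so the quadratic limit applies here as well.\<close>
    have "(\<lambda>n. real n * (\<integral>x. sin (t * \<Delta> n x) * tanh (\<Delta> n x / 2) \<partial>P)) \<longlonglongrightarrow> t / 2 * s\<^sup>2"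
      unfolding s2[symmetric]
      by (rule scaled_quadratic_expectation_limit[OF _ sin_tanh_lim sin_bound _ _ conv S dom])
         (simp_all add: tanh_real_altdef)
    then have Im_lim: "(\<lambda>n. real n * Im (\<phi> n)) \<longlonglongrightarrow> t * s\<^sup>2 / 2"
      by (simp add: Im involution_sin_identity[OF \<open>prob_space P\<close> _ rev])
    have "(\<lambda>n. of_nat n * (\<phi> n - 1)) \<longlonglongrightarrow> Complex (- (t\<^sup>2 * s\<^sup>2 / 2)) (t * s\<^sup>2 / 2)"
      using Re_lim Im_lim by (simp add: tendsto_complex_iff)
    moreover have "norm (\<phi> n) \<le> 1" for n
    proof -
      have "norm (\<phi> n) \<le> (\<integral>x. norm (iexp (t * \<Delta> n x)) \<partial>P)"
        unfolding \<phi>_def by (rule integral_norm_bound)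
      then show ?thesis
        by (simp add: prob_space)
    qed
    \<comment> \<open>The closing \<open>simp\<close> checks that the limiting exponent has real
      part at most 0.\<close>
    ultimately show ?thesis
      unfolding char_\<mu> char_\<nu> by (rule tendsto_power_exp_complex) simp
  qed
  with \<mu>_real \<nu>_real have "weak_conv_m \<mu> \<nu>"
    by (rule levy_continuity)
  \<comment> \<open>The acceptance function is bounded and continuous, so convergence in law carries
    over to its expectation.\<close>
  have cont: "isCont (\<lambda>y. min 1 (exp (- y))) x" for x :: real
    by (intro continuous_intros)
  have bdd: "norm (min 1 (exp (- y))) \<le> 1" for y :: real
    by (simp add: min_def)
  have "(\<lambda>n. \<integral>y. min 1 (exp (- y)) \<partial>\<mu> n) \<longlonglongrightarrow> (\<integral>y. min 1 (exp (- y)) \<partial>\<nu>)"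
    by (rule weak_conv_imp_integral_bdd_continuous_conv[OF \<mu>_real \<nu>_real \<open>weak_conv_m \<mu> \<nu>\<close> cont bdd])
  moreover have "(\<integral>y. min 1 (exp (- y)) \<partial>\<mu> n)
      = (\<integral>X. min 1 (exp (- (\<Sum>i<n. \<Delta> n (X i)))) \<partial>(\<Pi>\<^sub>M i\<in>{..<n}. P))" for n
    unfolding \<mu>_def by (subst integral_distr) simp_all
  moreover have "(\<integral>y. min 1 (exp (- y)) \<partial>\<nu>) = 2 * cdf std_normal_distribution (- s / 2)"
    unfolding \<nu>_def expectation_min_exp_normal[OF s0, symmetric] by (subst integral_distr) simp_all
  ultimately show ?thesis
    by (simp only: s_def)
qed

section \<open>The leapfrog map\<close>

text \<open>As \<open>gradient\<close> is a definite description, existence and uniqueness are both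
  needed. A representing vector has the values of the derivative on the basis as its coordinates;
  uniqueness follows from that of the derivative.\<close>

lemma gderiv_gradient:
  fixes V :: "'a::euclidean_space \<Rightarrow> real"
  assumes "V differentiable (at q)"
  shows "GDERIV V q :> gradient V q"
proof -
  obtain D where D: "(V has_derivative D) (at q)"
    using assms by (auto simp: differentiable_def)
  then interpret D: linear D
    by (rule has_derivative_linear)
  have "D h = h \<bullet> (\<Sum>b\<in>Basis. D b *\<^sub>R b)" for h
  proof -
    have "D h = D (\<Sum>b\<in>Basis. (h \<bullet> b) *\<^sub>R b)"
      by (simp add: euclidean_representation)
    also have "\<dots> = (\<Sum>b\<in>Basis. (h \<bullet> b) * D b)"
      by (simp add: D.sum D.scaleR)
    also have "\<dots> = h \<bullet> (\<Sum>b\<in>Basis. D b *\<^sub>R b)"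
      by (simp add: inner_sum_right mult.commute)
    finally show ?thesis .
  qed
  then have "D = (\<lambda>h. h \<bullet> (\<Sum>b\<in>Basis. D b *\<^sub>R b))" ..
  with D have *: "GDERIV V q :> (\<Sum>b\<in>Basis. D b *\<^sub>R b)"
    unfolding gderiv_def by (rule has_derivative_subst)
  have "g = g'" if "GDERIV V q :> g" "GDERIV V q :> g'" for g g'
  proof (rule euclidean_eqI)
    fix b :: 'a
    show "g \<bullet> b = g' \<bullet> b"
      using fun_cong[OF has_derivative_unique[OF that[unfolded gderiv_def]], of b]
      by (simp add: inner_commute)
  qed
  with * show ?thesis
    unfolding gradient_def by (rule theI2) (use * in blast)+
qed

text \<open>The gradient of a merely differentiable function can be discontinuous. Each coordinate
  is still a pointwise limit of difference quotients of the continuous function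
  \<open>V\<close>.\<close>

lemma borel_measurable_gradient:
  fixes V :: "'a::euclidean_space \<Rightarrow> real"
  assumes V: "\<And>q. V differentiable (at q)"
  shows "gradient V \<in> borel_measurable borel"
proof (subst borel_measurable_euclidean_space, intro ballI)
  fix b :: 'a assume "b \<in> Basis"
  have [measurable]: "V \<in> borel_measurable borel"
    by (intro borel_measurable_continuous_onI continuous_at_imp_continuous_on ballI
        differentiable_imp_continuous_within V)
  have diff_quot: "(\<lambda>q. (V (q + c *\<^sub>R b) - V q) / c) \<in> borel_measurable borel" for c :: real
    by measurable
  have lim: "(\<lambda>n. (V (q + inverse (real (Suc n)) *\<^sub>R b) - V q) / inverse (real (Suc n)))
      \<longlonglongrightarrow> gradient V q \<bullet> b" for q
  proof -
    have "((\<lambda>s. q + s *\<^sub>R b) has_derivative (\<lambda>s. s *\<^sub>R b)) (at 0)"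
      by (auto intro!: derivative_eq_intros)
    moreover have "(V has_derivative (\<lambda>h. h \<bullet> gradient V q)) (at (q + 0 *\<^sub>R b))"
      using gderiv_gradient[OF V, of q] by (simp add: gderiv_def)
    ultimately have "((\<lambda>s. V (q + s *\<^sub>R b)) has_derivative (\<lambda>s. (s *\<^sub>R b) \<bullet> gradient V q)) (at 0)"
      by (rule has_derivative_compose)
    then have "((\<lambda>s. V (q + s *\<^sub>R b)) has_field_derivative (gradient V q \<bullet> b)) (at 0)"
      by (simp add: has_field_derivative_def mult_commute_abs inner_commute)
    then have "((\<lambda>s. (V (q + s *\<^sub>R b) - V q) / s) \<longlongrightarrow> gradient V q \<bullet> b) (at 0)"
      by (simp add: DERIV_def)
    moreover have "filterlim (\<lambda>n. inverse (real (Suc n))) (at 0) sequentially"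
      unfolding filterlim_at using LIMSEQ_inverse_real_of_nat by (simp del: of_nat_Suc)
    ultimately show ?thesis
      by (rule filterlim_compose[where g = "\<lambda>s. (V (q + s *\<^sub>R b) - V q) / s"])
  qed
  show "(\<lambda>q. gradient V q \<bullet> b) \<in> borel_measurable borel"
    by (rule borel_measurable_LIMSEQ_real[OF lim diff_quot])
qed

section \<open>Time reversal\<close>

definition flip_momentum :: "'m::finite phase \<Rightarrow> 'm phase" where
  "flip_momentum = (\<lambda>(q, p). (q, - p))"

lemma flip_flip_momentum [simp]: "flip_momentum (flip_momentum x) = x"
  by (simp add: flip_momentum_def split: prod.split)

lemma matrix_vector_mult_uminus: "A *v (- x) = - (A *v x)" for A :: "real ^ 'n ^ 'm"
  using matrix_vector_mult_scaleR[of A "-1" x] by simp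

lemma hamiltonian_flip_momentum [simp]: "hamiltonian M V (flip_momentum x) = hamiltonian M V x"
  by (cases x) (simp add: hamiltonian_def flip_momentum_def matrix_vector_mult_uminus)

text \<open>The step is a palindrome: half kick, drift, half kick. Started from the flipped
  endpoint, the first kick gives the negated half-step momentum \<open>- r\<close>, the drift
  returns to \<open>q\<close>, and the last kick gives \<open>- p\<close>.\<close>

lemma leapfrog_reversible:
  "leapfrog M V h (flip_momentum (leapfrog M V h x)) = flip_momentum x"
proof (cases x)
  case (Pair q p)
  define r where "r = p - (h / 2) *\<^sub>R gradient V q"
  define q' where "q' = q + h *\<^sub>R (matrix_inv M *v r)"
  have 1: "leapfrog M V h x = (q', r - (h / 2) *\<^sub>R gradient V q')"
    by (simp add: leapfrog_def Pair r_def q'_def Let_def)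
  have "q' + h *\<^sub>R (matrix_inv M *v (- r)) = q"
    by (simp add: q'_def matrix_vector_mult_uminus)
  moreover have "- (r - (h / 2) *\<^sub>R gradient V q') - (h / 2) *\<^sub>R gradient V q' = - r"
    by simp
  moreover have "- r - (h / 2) *\<^sub>R gradient V q = - p"
    by (simp add: r_def)
  ultimately show ?thesis
    unfolding 1 by (simp only: leapfrog_def flip_momentum_def Pair Let_def prod.case)
qed

lemma leapfrog_flow_reversible:
  "leapfrog_flow M V T h (flip_momentum (leapfrog_flow M V T h x)) = flip_momentum x"
proof -
  have "(leapfrog M V h ^^ n) (flip_momentum ((leapfrog M V h ^^ n) x)) = flip_momentum x" for n
  proof (induction n arbitrary: x)
    case (Suc n)
    \<comment> \<open>The first step after the flip cancels the last step before it, which leaves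
      the induction hypothesis for \<open>n\<close>.\<close>
    have "(leapfrog M V h ^^ Suc n) (flip_momentum ((leapfrog M V h ^^ Suc n) x))
        = (leapfrog M V h ^^ n) (leapfrog M V h (flip_momentum (leapfrog M V h ((leapfrog M V h ^^ n) x))))"
      by (simp add: funpow_swap1)
    then show ?case
      by (simp add: leapfrog_reversible Suc)
  qed simp
  then show ?thesis
    by (simp add: leapfrog_flow_def)
qed

section \<open>Preservation of Lebesgue measure\<close>

definition measure_preserving_on :: "'a measure \<Rightarrow> ('a \<Rightarrow> 'a) \<Rightarrow> bool" where
  "measure_preserving_on N f \<longleftrightarrow> f \<in> measurable N N \<and> distr N N f = N"

lemma measure_preserving_on_compose:
  assumes "measure_preserving_on N f" "measure_preserving_on N g"
  shows "measure_preserving_on N (\<lambda>x. g (f x))"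
proof -
  have "distr N N (\<lambda>x. g (f x)) = distr (distr N N f) N g"
    using assms by (subst distr_distr) (auto simp: measure_preserving_on_def comp_def)
  then show ?thesis
    using assms by (auto simp: measure_preserving_on_def intro: measurable_compose)
qed

lemma measure_preserving_on_funpow:
  assumes "measure_preserving_on N f"
  shows "measure_preserving_on N (f ^^ n)"
proof (induction n)
  case 0
  show ?case
    by (simp add: measure_preserving_on_def distr_id id_def)
next
  case (Suc n)
  show ?case
    using measure_preserving_on_compose[OF Suc assms] by (simp add: comp_def)
qed

text \<open>By Tonelli, it is enough that for fixed \<open>q\<close> the translation by
  \<open>g q\<close> preserves Lebesgue measure. No Jacobian enters, which matters because
  \<open>g\<close> will be a gradient known only to be measurable.\<close>

lemma measure_preserving_shear_snd:
  fixes g :: "'a::euclidean_space \<Rightarrow> 'b::euclidean_space"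
  assumes [measurable]: "g \<in> borel_measurable borel"
  shows "measure_preserving_on lborel (\<lambda>x. (fst x, snd x + g (fst x)))"
proof -
  have m[measurable]: "(\<lambda>x::'a \<times> 'b. (fst x, snd x + g (fst x))) \<in> measurable borel borel"
    by (subst (1 2) borel_prod[symmetric]) measurable
  have "distr lborel lborel (\<lambda>x. (fst x, snd x + g (fst x))) = (lborel :: ('a \<times> 'b) measure)"
  proof (rule measure_eqI)
    fix A :: "('a \<times> 'b) set" assume "A \<in> sets (distr lborel lborel (\<lambda>x. (fst x, snd x + g (fst x))))"
    then have [measurable]: "A \<in> sets borel" by simp
    then have [measurable]: "A \<in> sets (borel \<Otimes>\<^sub>M borel)"
      unfolding borel_prod .
    have "emeasure (distr lborel lborel (\<lambda>x. (fst x, snd x + g (fst x)))) A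
        = (\<integral>\<^sup>+x. indicator A x \<partial>distr lborel lborel (\<lambda>x. (fst x, snd x + g (fst x))))"
      by simp
    also have "\<dots> = (\<integral>\<^sup>+x. indicator A (fst x, snd x + g (fst x)) \<partial>(lborel \<Otimes>\<^sub>M lborel))"
      unfolding lborel_prod by (subst nn_integral_distr) simp_all
    also have "\<dots> = (\<integral>\<^sup>+q. \<integral>\<^sup>+p. indicator A (q, p + g q) \<partial>lborel \<partial>lborel)"
      by (subst lborel.nn_integral_fst[symmetric]) simp_all
    also have "\<dots> = (\<integral>\<^sup>+q. \<integral>\<^sup>+p. indicator A (q, p) \<partial>lborel \<partial>lborel)"
    proof (rule nn_integral_cong)
      fix q
      have "(\<integral>\<^sup>+p. indicator A (q, p) \<partial>lborel) = (\<integral>\<^sup>+p. indicator A (q, p) \<partial>distr lborel borel ((+) (g q)))"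
        by (simp add: lborel_distr_plus)
      also have "\<dots> = (\<integral>\<^sup>+p. indicator A (q, p + g q) \<partial>lborel)"
        by (subst nn_integral_distr) (simp_all add: add.commute)
      finally show "(\<integral>\<^sup>+p. indicator A (q, p + g q) \<partial>lborel) = (\<integral>\<^sup>+p. indicator A (q, p) \<partial>lborel)" ..
    qed
    also have "\<dots> = (\<integral>\<^sup>+x. indicator A x \<partial>(lborel \<Otimes>\<^sub>M lborel))"
      by (subst lborel.nn_integral_fst[symmetric]) simp_all
    also have "\<dots> = emeasure lborel A"
      by (simp add: lborel_prod)
    finally show "emeasure (distr lborel lborel (\<lambda>x. (fst x, snd x + g (fst x)))) A = emeasure lborel A" .
  qed simp
  then show ?thesis
    by (simp add: measure_preserving_on_def)
qed

lemma lborel_distr_swap: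
  "distr lborel borel (\<lambda>(y, x). (x, y)) = (lborel :: ('b::euclidean_space \<times> 'a::euclidean_space) measure)"
proof -
  have psf: "pair_sigma_finite (lborel :: 'b measure) (lborel :: 'a measure)" ..
  have "distr lborel borel (\<lambda>(y, x). (x, y))
      = distr (lborel \<Otimes>\<^sub>M lborel) (lborel \<Otimes>\<^sub>M lborel) (\<lambda>(y :: 'a, x :: 'b). (x, y))"
    unfolding lborel_prod by (rule distr_cong) simp_all
  also have "\<dots> = lborel \<Otimes>\<^sub>M lborel"
    by (rule pair_sigma_finite.distr_pair_swap[OF psf, symmetric])
  finally show ?thesis
    by (simp only: lborel_prod)
qed

text \<open>Conjugation by the coordinate swap reduces this to the shear in the second
  component.\<close>

lemma measure_preserving_shear_fst:
  fixes g :: "'b::euclidean_space \<Rightarrow> 'a::euclidean_space"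
  assumes [measurable]: "g \<in> borel_measurable borel"
  shows "measure_preserving_on lborel (\<lambda>x. (fst x + g (snd x), snd x))"
proof -
  let ?s = "\<lambda>(x, y). (y, x)"
  have [measurable]: "?s \<in> measurable (borel :: ('a \<times> 'b) measure) borel"
    and [measurable]: "?s \<in> measurable (borel :: ('b \<times> 'a) measure) borel"
    unfolding borel_prod[symmetric] by (rule measurable_pair_swap')+
  let ?f = "\<lambda>x::'b \<times> 'a. (fst x, snd x + g (fst x))"
  have f: "?f \<in> measurable borel borel" "distr lborel borel ?f = lborel"
    using measure_preserving_shear_snd[OF assms]
    by (simp_all add: measure_preserving_on_def cong: distr_cong)
  note f(1)[measurable]
  have eq: "(\<lambda>x. (fst x + g (snd x), snd x)) = (\<lambda>x. ?s (?f (?s x)))"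
    by auto
  have "distr lborel borel (\<lambda>x. ?s (?f (?s x)))
      = distr (distr (distr lborel borel ?s) borel ?f) borel ?s"
    by (simp add: distr_distr comp_def)
  also have "\<dots> = lborel"
    by (simp only: lborel_distr_swap f(2))
  finally have "distr lborel lborel (\<lambda>x. ?s (?f (?s x))) = lborel"
    by (simp cong: distr_cong)
  moreover have "(\<lambda>x. ?s (?f (?s x))) \<in> measurable borel borel"
    by measurable
  ultimately show ?thesis
    unfolding eq by (simp add: measure_preserving_on_def)
qed

lemma borel_measurable_matrix_vector_mult [measurable (raw)]:
  fixes A :: "real ^ 'n ^ 'm"
  assumes "f \<in> borel_measurable N"
  shows "(\<lambda>x. A *v f x) \<in> borel_measurable N"
  using assms by (rule measurable_compose)
    (intro borel_measurable_continuous_onI linear_continuous_on matrix_vector_mul_bounded_linear)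

text \<open>Kick, drift and kick are three shears: in each, one coordinate moves by a function of
  the other.\<close>

lemma leapfrog_measure_preserving:
  fixes V :: "real ^ 'm \<Rightarrow> real"
  assumes V: "\<And>q. V differentiable (at q)"
  shows "measure_preserving_on lborel (leapfrog M V h)"
proof -
  note borel_measurable_gradient[OF V, measurable]
  have kick: "measure_preserving_on lborel (\<lambda>x. (fst x, snd x + (- (h / 2)) *\<^sub>R gradient V (fst x)))"
    by (rule measure_preserving_shear_snd) measurable
  have drift: "measure_preserving_on lborel (\<lambda>x. (fst x + h *\<^sub>R (matrix_inv M *v snd x), snd x))"
    by (rule measure_preserving_shear_fst) measurable
  show ?thesis
    using measure_preserving_on_compose[OF measure_preserving_on_compose[OF kick drift] kick]
    by (rule back_subst[where P = "measure_preserving_on lborel"])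
       (simp add: leapfrog_def case_prod_unfold Let_def fun_eq_iff)
qed

lemma leapfrog_flow_measure_preserving:
  fixes V :: "real ^ 'm \<Rightarrow> real"
  assumes V: "\<And>q. V differentiable (at q)"
  shows "measure_preserving_on lborel (leapfrog_flow M V T h)"
  unfolding leapfrog_flow_def
  by (intro measure_preserving_on_funpow leapfrog_measure_preserving V)

lemma flip_momentum_measure_preserving: "measure_preserving_on lborel (flip_momentum :: 'm::finite phase \<Rightarrow> _)"
proof -
  have u: "distr lborel borel uminus = (lborel :: (real ^ 'm) measure)"
    using lborel_affine[of "- 1" "0 :: real ^ 'm"] by (simp add: density_1)
  have "distr (lborel \<Otimes>\<^sub>M lborel) (borel \<Otimes>\<^sub>M borel) (\<lambda>(q :: real ^ 'm, p :: real ^ 'm). (q, - p))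
      = distr lborel borel (\<lambda>x. x) \<Otimes>\<^sub>M distr lborel borel uminus"
    by (rule pair_measure_distr[symmetric]) (simp_all add: u sigma_finite_lborel)
  then have "distr lborel borel (flip_momentum :: 'm phase \<Rightarrow> _) = lborel"
    by (simp add: u distr_id2 lborel_prod borel_prod flip_momentum_def)
  moreover have "(flip_momentum :: 'm phase \<Rightarrow> _) \<in> measurable borel borel"
    unfolding flip_momentum_def by (subst (1 2) borel_prod[symmetric]) measurable
  ultimately show ?thesis
    by (simp add: measure_preserving_on_def cong: distr_cong)
qed

section \<open>Gibbs measures\<close>

lemma borel_measurable_gibbs_density [measurable]:
  assumes [measurable]: "E \<in> borel_measurable N"
  shows "(\<lambda>x. ennreal (exp (- E x) / Z)) \<in> borel_measurable N"
  by measurable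

lemma gibbs_measure_simps [simp]:
  "sets (gibbs_measure N E) = sets N" "space (gibbs_measure N E) = space N"
  by (simp_all add: gibbs_measure_def)

lemma prob_space_gibbs_measure:
  assumes int: "integrable N (\<lambda>x. exp (- E x))" and pos: "(\<integral>x. exp (- E x) \<partial>N) > 0"
  shows "prob_space (gibbs_measure N E)"
proof
  let ?Z = "\<integral>x. exp (- E x) \<partial>N"
  have [measurable]: "(\<lambda>x. exp (- E x)) \<in> borel_measurable N"
    using int by auto
  have "emeasure (gibbs_measure N E) (space (gibbs_measure N E)) = (\<integral>\<^sup>+x. ennreal (exp (- E x) / ?Z) \<partial>N)"
    unfolding gibbs_measure_def by (simp add: emeasure_density cong: nn_integral_cong)
  also have "\<dots> = ennreal (\<integral>x. exp (- E x) / ?Z \<partial>N)"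
    using int pos by (intro nn_integral_eq_integral) auto
  also have "\<dots> = 1"
    using pos by simp
  finally show "emeasure (gibbs_measure N E) (space (gibbs_measure N E)) = 1" .
qed

text \<open>For an additive energy, the weight and, by Fubini, the normalizing constant both
  factorize; agreement on boxes then identifies the product measure. This is the independence of the
  particles in stationarity.\<close>

lemma gibbs_measure_PiM:
  fixes E :: "'a \<Rightarrow> real"
  assumes N: "sigma_finite_measure N" and [measurable]: "E \<in> borel_measurable N"
    and int: "integrable N (\<lambda>x. exp (- E x))" and pos: "(\<integral>x. exp (- E x) \<partial>N) > 0" and I: "finite I"
  shows "gibbs_measure (\<Pi>\<^sub>M i\<in>I. N) (\<lambda>X. \<Sum>i\<in>I. E (X i)) = (\<Pi>\<^sub>M i\<in>I. gibbs_measure N E)"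
proof -
  let ?Z = "\<integral>x. exp (- E x) \<partial>N" and ?G = "gibbs_measure N E"
  interpret N: sigma_finite_measure N by fact
  interpret NI: product_sigma_finite "\<lambda>_. N" ..
  interpret G: prob_space ?G
    by (rule prob_space_gibbs_measure[OF int pos])
  interpret GI: product_sigma_finite "\<lambda>_. ?G" ..
  have prod: "exp (- (\<Sum>i\<in>I. E (X i))) = (\<Prod>i\<in>I. exp (- E (X i)))" for X
    by (simp add: exp_sum[OF I] flip: sum_negf)
  have Z: "(\<integral>X. (\<Prod>i\<in>I. exp (- E (X i))) \<partial>(\<Pi>\<^sub>M i\<in>I. N)) = (\<Prod>i\<in>I. ?Z)"
    using I int by (rule NI.product_integral_prod)
  show ?thesis
  proof (rule GI.PiM_eqI[OF I])
    show "sets (gibbs_measure (\<Pi>\<^sub>M i\<in>I. N) (\<lambda>X. \<Sum>i\<in>I. E (X i))) = sets (\<Pi>\<^sub>M i\<in>I. ?G)"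
      by (simp cong: sets_PiM_cong)
    fix A assume "\<And>i. i \<in> I \<Longrightarrow> A i \<in> sets ?G"
    then have A[measurable]: "\<And>i. i \<in> I \<Longrightarrow> A i \<in> sets N"
      by simp
    have "emeasure (gibbs_measure (\<Pi>\<^sub>M i\<in>I. N) (\<lambda>X. \<Sum>i\<in>I. E (X i))) (Pi\<^sub>E I A)
        = (\<integral>\<^sup>+X. ennreal ((\<Prod>i\<in>I. exp (- E (X i))) / (\<Prod>i\<in>I. ?Z)) * indicator (Pi\<^sub>E I A) X \<partial>(\<Pi>\<^sub>M i\<in>I. N))"
      unfolding gibbs_measure_def prod Z using A I
      by (intro emeasure_density sets_PiM_I_finite) auto
    also have "\<dots> = (\<integral>\<^sup>+X. (\<Prod>i\<in>I. ennreal (exp (- E (X i)) / ?Z) * indicator (A i) (X i)) \<partial>(\<Pi>\<^sub>M i\<in>I. N))"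
    proof (rule nn_integral_cong)
      fix X assume "X \<in> space (\<Pi>\<^sub>M i\<in>I. N)"
      then have "indicator (Pi\<^sub>E I A) X = (\<Prod>i\<in>I. indicator (A i) (X i) :: ennreal)"
        using I by (auto simp: indicator_def space_PiM PiE_iff)
      moreover have "ennreal ((\<Prod>i\<in>I. exp (- E (X i))) / (\<Prod>i\<in>I. ?Z)) = (\<Prod>i\<in>I. ennreal (exp (- E (X i)) / ?Z))"
        using pos by (subst prod_ennreal) (auto simp: prod_dividef)
      ultimately show "ennreal ((\<Prod>i\<in>I. exp (- E (X i))) / (\<Prod>i\<in>I. ?Z)) * indicator (Pi\<^sub>E I A) X
          = (\<Prod>i\<in>I. ennreal (exp (- E (X i)) / ?Z) * indicator (A i) (X i))"
        by (simp add: prod.distrib)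
    qed
    also have "\<dots> = (\<Prod>i\<in>I. \<integral>\<^sup>+x. ennreal (exp (- E x) / ?Z) * indicator (A i) x \<partial>N)"
      using I by (intro NI.product_nn_integral_prod) auto
    also have "\<dots> = (\<Prod>i\<in>I. emeasure ?G (A i))"
      unfolding gibbs_measure_def by (intro prod.cong) (auto simp: emeasure_density)
    finally show "emeasure (gibbs_measure (\<Pi>\<^sub>M i\<in>I. N) (\<lambda>X. \<Sum>i\<in>I. E (X i))) (Pi\<^sub>E I A)
        = (\<Prod>i\<in>I. emeasure ?G (A i))" .
  qed
qed

text \<open>Substituting \<open>F x\<close> for \<open>x\<close> exchanges \<open>E x\<close> and
  \<open>E (F x)\<close>, so the energy difference changes sign, while the Gibbs weight is
  multiplied by \<open>exp (- (E (F x) - E x))\<close>.\<close>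

lemma gibbs_measure_involution:
  fixes E :: "'a \<Rightarrow> real"
  assumes [measurable]: "E \<in> borel_measurable N"
    and F: "measure_preserving_on N F" and inv: "\<And>x. F (F x) = x"
  shows "distr (gibbs_measure N E) borel (\<lambda>x. - (E (F x) - E x))
       = density (distr (gibbs_measure N E) borel (\<lambda>x. E (F x) - E x)) (\<lambda>y. ennreal (exp (- y)))"
    (is "?L = ?R")
proof (rule measure_eqI)
  let ?Z = "\<integral>x. exp (- E x) \<partial>N"
  have F_meas[measurable]: "F \<in> measurable N N" and F_distr: "distr N N F = N"
    using F by (auto simp: measure_preserving_on_def)
  show "sets ?L = sets ?R" by simp
  fix A assume "A \<in> sets ?L"
  then have [measurable]: "A \<in> sets borel" by simp
  have "emeasure ?L A = (\<integral>\<^sup>+y. indicator A y \<partial>?L)"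
    by simp
  also have "\<dots> = (\<integral>\<^sup>+x. ennreal (exp (- E x) / ?Z) * indicator A (- (E (F x) - E x)) \<partial>N)"
    unfolding gibbs_measure_def by (subst nn_integral_distr, simp, simp, subst nn_integral_density) simp_all
  \<comment> \<open>Invariance of \<open>N\<close> is read from right to left to introduce
    \<open>F\<close>; in the next step \<open>inv\<close> collapses \<open>F (F x)\<close>.\<close>
  also have "\<dots> = (\<integral>\<^sup>+x. ennreal (exp (- E x) / ?Z) * indicator A (- (E (F x) - E x)) \<partial>distr N N F)"
    by (simp only: F_distr)
  also have "\<dots> = (\<integral>\<^sup>+x. ennreal (exp (- E (F x)) / ?Z) * indicator A (E (F x) - E x) \<partial>N)"
    by (subst nn_integral_distr) (simp_all add: inv)
  also have "\<dots> = (\<integral>\<^sup>+x. ennreal (exp (- E x) / ?Z) *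
      (ennreal (exp (- (E (F x) - E x))) * indicator A (E (F x) - E x)) \<partial>N)"
  proof (rule nn_integral_cong)
    fix x
    have "exp (- E (F x)) = exp (- E x) * exp (- (E (F x) - E x))"
      unfolding exp_add[symmetric] by simp
    then have "exp (- E (F x)) / ?Z = exp (- E x) / ?Z * exp (- (E (F x) - E x))"
      by simp
    then show "ennreal (exp (- E (F x)) / ?Z) * indicator A (E (F x) - E x)
        = ennreal (exp (- E x) / ?Z) * (ennreal (exp (- (E (F x) - E x))) * indicator A (E (F x) - E x))"
      by (simp only: ennreal_mult'' exp_ge_zero mult.assoc)
  qed
  also have "\<dots> = emeasure ?R A"
    unfolding gibbs_measure_def by (simp add: emeasure_density nn_integral_distr nn_integral_density)
  finally show "emeasure ?L A = emeasure ?R A" .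
qed

section \<open>Normalizability of the single-particle target\<close>

text \<open>Positivity forces a trivial kernel, so \<open>matrix_inv M\<close> is a genuine inverse.
  With \<open>v = matrix_inv M *v p\<close>, the form becomes
  \<open>(M *v v) \<bullet> v\<close>.\<close>

lemma matrix_inv_pos_def:
  fixes M :: "real ^ 'm ^ 'm"
  assumes "symmetric_pos_def M" "p \<noteq> 0"
  shows "p \<bullet> (matrix_inv M *v p) > 0"
proof -
  have pos: "\<And>v. v \<noteq> 0 \<Longrightarrow> v \<bullet> (M *v v) > 0"
    using assms by (auto simp: symmetric_pos_def_def)
  have "x = 0" if "M *v x = 0" for x
    using pos[of x] that by (cases "x = 0") auto
  then have "invertible M"
    by (simp add: invertible_left_inverse matrix_left_invertible_ker)
  then have "M ** matrix_inv M = mat 1"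
    unfolding matrix_inv_def invertible_def by (rule someI2_ex) simp
  then have "M *v (matrix_inv M *v p) = p"
    by (simp add: matrix_vector_mul_assoc)
  then show ?thesis
    using pos[of "matrix_inv M *v p"] assms(2) by (metis inner_commute matrix_vector_mult_0_right)
qed

text \<open>The constant is the minimum of the form on the compact unit sphere; homogeneity extends
  the bound to all vectors.\<close>

lemma quadratic_form_lower_bound:
  fixes A :: "real ^ 'm ^ 'm"
  assumes pos: "\<And>p. p \<noteq> 0 \<Longrightarrow> p \<bullet> (A *v p) > 0"
  obtains c where "c > 0" "\<And>p. c * (norm p)\<^sup>2 \<le> p \<bullet> (A *v p)"
proof -
  have sphere: "compact (sphere (0 :: real ^ 'm) 1)" "sphere (0 :: real ^ 'm) 1 \<noteq> {}"
    by simp_all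
  have "continuous_on (sphere 0 1) (\<lambda>p. p \<bullet> (A *v p))"
    by (intro continuous_intros linear_continuous_on matrix_vector_mul_bounded_linear)
  from continuous_attains_inf[OF sphere this] obtain u where u: "u \<in> sphere 0 1" "\<And>y. y \<in> sphere 0 1 \<Longrightarrow> u \<bullet> (A *v u) \<le> y \<bullet> (A *v y)"
    by blast
  have "u \<bullet> (A *v u) * (norm p)\<^sup>2 \<le> p \<bullet> (A *v p)" for p
  proof (cases "p = 0")
    case False
    define y where "y = p /\<^sub>R norm p"
    have p: "p = norm p *\<^sub>R y"
      using False by (simp add: y_def)
    have "p \<bullet> (A *v p) = (norm p)\<^sup>2 * (y \<bullet> (A *v y))"
      by (subst (1 2) p) (simp add: matrix_vector_mult_scaleR power2_eq_square)
    moreover have "u \<bullet> (A *v u) \<le> y \<bullet> (A *v y)"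
      using False by (intro u) (simp add: y_def)
    ultimately show ?thesis
      by (simp add: mult.commute[of _ "(norm p)\<^sup>2"] mult_left_mono)
  qed simp
  moreover have "u \<bullet> (A *v u) > 0"
    using u by (intro pos) auto
  ultimately show ?thesis
    using that by blast
qed

lemma nn_integral_gaussian_finite:
  assumes c: "c > 0"
  shows "(\<integral>\<^sup>+p. ennreal (exp (- (c * (norm (p :: 'a::euclidean_space))\<^sup>2))) \<partial>lborel) < \<infinity>"
proof -
  have 1: "(\<integral>\<^sup>+x. ennreal (exp (- (c * x\<^sup>2))) \<partial>lborel) < \<infinity>"
  proof -
    \<comment> \<open>This is the standard deviation for which a centred normal density has exponent
      \<open>- c * x^2\<close>.\<close>
    define \<sigma> where "\<sigma> = 1 / sqrt (2 * c)"
    have \<sigma>: "\<sigma> > 0" "2 * \<sigma>\<^sup>2 = 1 / c"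
      using c by (simp_all add: \<sigma>_def power_divide)
    have "exp (- (c * x\<^sup>2)) = sqrt (2 * pi * \<sigma>\<^sup>2) * normal_density 0 \<sigma> x" for x
      using \<sigma> by (simp add: normal_density_def mult.commute)
    moreover have "integrable lborel (\<lambda>x. sqrt (2 * pi * \<sigma>\<^sup>2) * normal_density 0 \<sigma> x)"
      using \<sigma> by simp
    ultimately have "integrable lborel (\<lambda>x::real. exp (- (c * x\<^sup>2)))"
      by simp
    then show ?thesis
      by (simp add: integrable_iff_bounded)
  qed
  have "ennreal (exp (- (c * (norm p)\<^sup>2))) = (\<Prod>b\<in>Basis. ennreal (exp (- (c * (p \<bullet> b)\<^sup>2))))" for p :: 'a
  proof -
    have "(norm p)\<^sup>2 = (\<Sum>b\<in>Basis. (p \<bullet> b)\<^sup>2)"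
      unfolding power2_norm_eq_inner by (subst euclidean_inner) (simp add: power2_eq_square)
    then show ?thesis
      by (simp add: prod_ennreal exp_sum sum_distrib_left flip: sum_negf)
  qed
  then have "(\<integral>\<^sup>+p. ennreal (exp (- (c * (norm (p :: 'a))\<^sup>2))) \<partial>lborel)
      = (\<Prod>b\<in>(Basis :: 'a set). \<integral>\<^sup>+x. ennreal (exp (- (c * x\<^sup>2))) \<partial>lborel)"
    by (subst nn_integral_lborel_prod[symmetric]) simp_all
  also have "\<dots> < \<infinity>"
    using 1 by (auto simp: ennreal_prod_eq_top power_less_top_ennreal)
  finally show ?thesis .
qed

lemma borel_measurable_hamiltonian:
  fixes V :: "real ^ 'm \<Rightarrow> real"
  assumes V: "\<And>q. V differentiable (at q)"
  shows "hamiltonian M V \<in> borel_measurable borel"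
proof -
  have [measurable]: "V \<in> borel_measurable borel"
    by (intro borel_measurable_continuous_onI continuous_at_imp_continuous_on ballI
        differentiable_imp_continuous_within V)
  show ?thesis
    unfolding hamiltonian_def case_prod_unfold by (subst borel_prod[symmetric]) measurable
qed

text \<open>The kinetic energy dominates a multiple of the squared norm of the momentum, so the
  weight is at most \<open>exp (- V q)\<close> times a Gaussian in \<open>p\<close>, and Tonelli
  separates the two integrals.\<close>

lemma integrable_exp_hamiltonian:
  fixes V :: "real ^ 'm \<Rightarrow> real"
  assumes M: "symmetric_pos_def M" and V: "\<And>q. V differentiable (at q)"
    and V_int: "(\<integral>\<^sup>+q. ennreal (exp (- V q)) \<partial>lborel) < \<infinity>"
  shows "integrable lborel (\<lambda>x. exp (- hamiltonian M V x))"
proof (rule integrableI_bounded)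
  have [measurable]: "V \<in> borel_measurable borel"
    by (intro borel_measurable_continuous_onI continuous_at_imp_continuous_on ballI
        differentiable_imp_continuous_within V)
  note borel_measurable_hamiltonian[OF V, measurable]
  show "(\<lambda>x. exp (- hamiltonian M V x)) \<in> borel_measurable lborel"
    by measurable
  obtain c where c: "c > 0" "\<And>p. c * (norm p)\<^sup>2 \<le> p \<bullet> (matrix_inv M *v p)"
    using quadratic_form_lower_bound[OF matrix_inv_pos_def[OF M]] by metis
  have "(\<integral>\<^sup>+x. ennreal (norm (exp (- hamiltonian M V x))) \<partial>lborel)
      \<le> (\<integral>\<^sup>+x. ennreal (exp (- V (fst (x :: 'm phase)))) * ennreal (exp (- (c / 2 * (norm (snd x))\<^sup>2))) \<partial>lborel)"
  proof (rule nn_integral_mono)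
    fix x :: "'m phase"
    have "- hamiltonian M V x \<le> - V (fst x) + - (c / 2 * (norm (snd x))\<^sup>2)"
      using c(2)[of "snd x"] by (simp add: hamiltonian_def case_prod_unfold)
    then have "exp (- hamiltonian M V x) \<le> exp (- V (fst x)) * exp (- (c / 2 * (norm (snd x))\<^sup>2))"
      by (simp only: exp_le_cancel_iff flip: exp_add)
    then show "ennreal (norm (exp (- hamiltonian M V x)))
        \<le> ennreal (exp (- V (fst x))) * ennreal (exp (- (c / 2 * (norm (snd x))\<^sup>2)))"
      by (subst ennreal_mult''[symmetric]) (simp_all only: real_norm_def abs_exp_cancel ennreal_leI exp_ge_zero)
  qed
  also have "\<dots> = (\<integral>\<^sup>+x. ennreal (exp (- V (fst (x :: 'm phase)))) * ennreal (exp (- (c / 2 * (norm (snd x))\<^sup>2)))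
      \<partial>(lborel \<Otimes>\<^sub>M lborel))"
    by (simp add: lborel_prod)
  also have "\<dots> = (\<integral>\<^sup>+q. \<integral>\<^sup>+p. ennreal (exp (- V q)) * ennreal (exp (- (c / 2 * (norm (p :: real ^ 'm))\<^sup>2)))
      \<partial>lborel \<partial>lborel)"
    by (subst lborel.nn_integral_fst[symmetric]) simp_all
  also have "\<dots> = (\<integral>\<^sup>+q. ennreal (exp (- V q)) \<partial>lborel)
      * (\<integral>\<^sup>+p. ennreal (exp (- (c / 2 * (norm (p :: real ^ 'm))\<^sup>2))) \<partial>lborel)"
    by (simp add: nn_integral_cmult nn_integral_multc)
  also have "\<dots> < \<infinity>"
    using V_int nn_integral_gaussian_finite[of "c / 2", where 'a = "real ^ 'm"] c(1) by (simp add: ennreal_mult_less_top)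
  finally show "(\<integral>\<^sup>+x. ennreal (norm (exp (- hamiltonian M V x))) \<partial>lborel) < \<infinity>" .
qed

lemma integral_exp_hamiltonian_pos:
  assumes "integrable lborel (\<lambda>x. exp (- hamiltonian M V x))"
  shows "(\<integral>x. exp (- hamiltonian M V x) \<partial>lborel) > 0"
proof -
  have "(\<integral>x. exp (- hamiltonian M V x) \<partial>lborel) \<noteq> 0"
  proof
    assume "(\<integral>x. exp (- hamiltonian M V x) \<partial>lborel) = 0"
    then have "AE x in lborel. exp (- hamiltonian M V x) = 0"
      using integral_nonneg_eq_0_iff_AE[OF assms] by simp
    then show False
      by (simp add: AE_iff_null null_sets_def)
  qed
  moreover have "(\<integral>x. exp (- hamiltonian M V x) \<partial>lborel) \<ge> 0"
    by (rule Bochner_Integration.integral_nonneg) simp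
  ultimately show ?thesis
    by linarith
qed

section \<open>Hybrid Monte Carlo\<close>

theorem theorem3p6:
  fixes M :: "real ^ 'm ^ 'm" and V :: "real ^ 'm \<Rightarrow> real" and T l :: real
    and \<alpha> :: "'m phase \<Rightarrow> real" and \<rho> :: "'m phase \<Rightarrow> real \<Rightarrow> real" and D :: "'m phase \<Rightarrow> real"
  assumes M: "symmetric_pos_def M"
    and T: "T > 0"
    and V_diff: "\<And>q. V differentiable (at q)"
    and V_int: "(\<integral>\<^sup>+ q. ennreal (exp (- V q)) \<partial>lborel) < \<infinity>"
    and expansion: "\<And>x h. h > 0 \<Longrightarrow> energy_error M V T x h = h ^ 2 * \<alpha> x + h ^ 2 * \<rho> x h"
    and remainder: "\<And>x. (\<rho> x \<longlongrightarrow> 0) (at_right 0)"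
    and dominated: "\<And>x. (SUP h\<in>{0<..1}. ereal (\<bar>energy_error M V T x h\<bar> ^ 2 / h ^ 4)) \<le> ereal (D x)"
    and D_int: "(\<integral>\<^sup>+ x. ennreal (D x * exp (- hamiltonian M V x)) \<partial>lborel) < \<infinity>"
    and l: "l > 0"
  shows "(\<lambda>d::nat. \<integral>X. hmc_accept M V d X
              (hmc_proposal M V T (l * real d powr (- 1 / 4)) d X) \<partial>joint_target M V d)
           \<longlonglongrightarrow> 2 * cdf std_normal_distribution
                  (- (l ^ 2) * sqrt (\<integral>x. (\<alpha> x) ^ 2 \<partial>single_target M V) / 2)"
proof -
  \<comment> \<open>At \<open>n = 0\<close> the convention \<open>0 powr x = 0\<close> gives step
    size 0, so facts on positivity and scaling of \<open>h\<close> are stated for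
    \<open>n > 0\<close>.\<close>
  define h where "h n = l * real n powr (- 1 / 4)" for n :: nat
  define \<Delta> where "\<Delta> n x = energy_error M V T x (h n)" for n x
  let ?H = "hamiltonian M V" and ?P = "single_target M V"
  have H[measurable]: "?H \<in> borel_measurable borel"
    by (rule borel_measurable_hamiltonian[OF V_diff])
  have int: "integrable lborel (\<lambda>x. exp (- ?H x))"
    by (rule integrable_exp_hamiltonian[OF M V_diff V_int])
  have pos: "(\<integral>x. exp (- ?H x) \<partial>lborel) > 0"
    by (rule integral_exp_hamiltonian_pos[OF int])
  have P: "prob_space ?P"
    unfolding single_target_def by (rule prob_space_gibbs_measure[OF int pos])
  have P_meas: "borel_measurable ?P = borel_measurable borel"
    unfolding single_target_def by (rule measurable_cong_sets) simp_all
  have joint: "joint_target M V n = (\<Pi>\<^sub>M i\<in>{..<n}. ?P)" for n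
    unfolding joint_target_def single_target_def
    by (rule gibbs_measure_PiM[OF sigma_finite_lborel _ int pos]) simp_all
  have \<Delta>_meas[measurable]: "\<Delta> n \<in> borel_measurable borel" for n
  proof -
    have "leapfrog_flow M V T (h n) \<in> measurable borel borel"
      using leapfrog_flow_measure_preserving[OF V_diff, of M T "h n"]
      by (simp add: measure_preserving_on_def)
    from borel_measurable_diff[OF measurable_compose[OF this H] H] show ?thesis
      by (simp only: \<Delta>_def[abs_def] energy_error_def)
  qed

  have rev: "distr ?P borel (\<lambda>x. - \<Delta> n x) = density (distr ?P borel (\<Delta> n)) (\<lambda>y. ennreal (exp (- y)))" for n
  proof -
    \<comment> \<open>The Hamiltonian is invariant under the flip, so appending it to the flow
      leaves \<open>\<Delta> n\<close> unchanged and produces an involution.\<close>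
    let ?F = "\<lambda>x. flip_momentum (leapfrog_flow M V T (h n) x)"
    have F: "measure_preserving_on lborel ?F"
      by (rule measure_preserving_on_compose[OF leapfrog_flow_measure_preserving[OF V_diff]
            flip_momentum_measure_preserving])
    have inv: "?F (?F x) = x" for x
      by (simp add: leapfrog_flow_reversible)
    have H': "?H \<in> borel_measurable lborel"
      by simp
    have eq: "\<Delta> n = (\<lambda>x. ?H (?F x) - ?H x)"
      by (rule ext) (simp add: \<Delta>_def energy_error_def)
    show ?thesis
      unfolding single_target_def eq by (rule gibbs_measure_involution[OF H' F inv])
  qed

  have h_pos: "h n > 0" if "n > 0" for n
    using that l by (simp add: h_def)
  \<comment> \<open>The exponent \<open>- 1 / 4\<close> makes \<open>sqrt n * h^2\<close> constant,
    so an error of order \<open>h^2\<close> is exactly on the central limit scale.\<close>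
  have h_sq: "sqrt (real n) * (h n)\<^sup>2 = l\<^sup>2" and h_four: "real n = l ^ 4 / h n ^ 4" if "n > 0" for n
  proof -
    have "(real n powr (- 1 / 4))\<^sup>2 = real n powr (- 1 / 2)"
      using that by (simp add: powr_power)
    moreover have "sqrt (real n) * real n powr (- 1 / 2) = 1"
      using that by (simp add: powr_half_sqrt[symmetric] flip: powr_add)
    ultimately show *: "sqrt (real n) * (h n)\<^sup>2 = l\<^sup>2"
      by (simp add: h_def power_mult_distrib)
    have "real n * h n ^ 4 = (sqrt (real n) * (h n)\<^sup>2)\<^sup>2"
      by (simp add: power_mult_distrib)
    then show "real n = l ^ 4 / h n ^ 4"
      using h_pos[OF that] * by (simp add: field_simps)
  qed
  have h_lim: "h \<longlonglongrightarrow> 0"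
  proof -
    have "(\<lambda>n. real n powr (- 1 / 4)) \<longlonglongrightarrow> 0"
      by (rule tendsto_neg_powr) (auto simp: filterlim_real_sequentially)
    then show ?thesis
      unfolding h_def using tendsto_mult_right_zero by blast
  qed
  have conv: "(\<lambda>n. sqrt (real n) * \<Delta> n x) \<longlonglongrightarrow> l\<^sup>2 * \<alpha> x" for x
  proof -
    have "\<forall>\<^sub>F n in sequentially. h n \<in> {0<..} \<and> h n \<noteq> 0"
      using eventually_gt_at_top[of "0 :: nat"]
    proof eventually_elim
      case (elim n)
      then show ?case
        using h_pos[of n] by simp
    qed
    then have "filterlim h (at_right 0) sequentially"
      using h_lim by (simp add: filterlim_at)
    then have "(\<lambda>n. \<rho> x (h n)) \<longlonglongrightarrow> 0"
      by (rule filterlim_compose[OF remainder])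
    then have "(\<lambda>n. l\<^sup>2 * (\<alpha> x + \<rho> x (h n))) \<longlonglongrightarrow> l\<^sup>2 * (\<alpha> x + 0)"
      by (intro tendsto_intros)
    moreover have "\<forall>\<^sub>F n in sequentially. l\<^sup>2 * (\<alpha> x + \<rho> x (h n)) = sqrt (real n) * \<Delta> n x"
      using eventually_gt_at_top[of 0]
    proof eventually_elim
      case (elim n)
      have "\<Delta> n x = (h n)\<^sup>2 * (\<alpha> x + \<rho> x (h n))"
        unfolding \<Delta>_def using expansion[OF h_pos[OF elim]] by (simp add: distrib_left)
      then show ?case
        using h_sq[OF elim] by (metis mult.assoc)
    qed
    ultimately show ?thesis
      using Lim_transform_eventually by fastforce
  qed

  \<comment> \<open>Beyond \<open>N\<close> the step sizes lie in the range \<open>{0<..1}\<close>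
    covered by \<open>dominated\<close>.\<close>
  have "\<forall>\<^sub>F n in sequentially. n > 0 \<and> h n < 1"
    using eventually_gt_at_top[of "0::nat"] order_tendstoD(2)[OF h_lim, of 1]
    by (auto intro: eventually_conj)
  then obtain N where N: "\<And>n. n \<ge> N \<Longrightarrow> n > 0 \<and> h n < 1"
    by (auto simp: eventually_sequentially)
  \<comment> \<open>\<open>D\<close> may be non-measurable; the supremum over the countably many step sizes \<open>h n\<close> replaces it.\<close>
  define S where "S x = (SUP n\<in>{N..}. (\<Delta> n x)\<^sup>2 / h n ^ 4)" for x
  have bound: "(\<Delta> n x)\<^sup>2 / h n ^ 4 \<le> D x" if "n \<ge> N" for n x
  proof -
    have "h n \<in> {0<..1}"
      using N[OF that] h_pos by auto
    then have "ereal (\<bar>energy_error M V T x (h n)\<bar> ^ 2 / h n ^ 4) \<le> ereal (D x)"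
      by (rule SUP_upper[THEN order_trans[OF _ dominated]])
    then show ?thesis
      by (simp add: \<Delta>_def)
  qed
  have bdd: "bdd_above ((\<lambda>n. (\<Delta> n x)\<^sup>2 / h n ^ 4) ` {N..})" for x
    by (rule bdd_aboveI2[where M = "D x"]) (simp add: bound)
  have S_upper: "(\<Delta> n x)\<^sup>2 / h n ^ 4 \<le> S x" if "n \<ge> N" for n x
    unfolding S_def by (rule cSUP_upper[OF _ bdd]) (use that in simp)
  have S_le: "S x \<le> D x" for x
    unfolding S_def by (rule cSUP_least) (simp_all add: bound)
  have S_nonneg: "S x \<ge> 0" for x
    using S_upper[of N x] by (rule order_trans[rotated]) (use h_pos N in auto)
  have S_meas[measurable]: "S \<in> borel_measurable borel"
    unfolding S_def by (rule borel_measurable_cSUP[OF _ _ bdd]) simp_all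
  have "integrable lborel (\<lambda>x. exp (- ?H x) * S x)"
  proof (rule integrableI_bounded)
    \<comment> \<open>The nonnegative integral is monotone for arbitrary integrands, so comparison
      with \<open>D\<close> is legitimate without its measurability.\<close>
    have "(\<integral>\<^sup>+x. ennreal (norm (exp (- ?H x) * S x)) \<partial>lborel)
        \<le> (\<integral>\<^sup>+x. ennreal (D x * exp (- ?H x)) \<partial>lborel)"
      using S_le S_nonneg by (intro nn_integral_mono ennreal_leI) (auto simp: abs_mult mult.commute)
    also note D_int
    finally show "(\<integral>\<^sup>+x. ennreal (norm (exp (- ?H x) * S x)) \<partial>lborel) < \<infinity>" .
  qed measurable
  then have "integrable lborel (\<lambda>x. exp (- ?H x) * S x / (\<integral>y. exp (- ?H y) \<partial>lborel))"
    by (rule integrable_divide)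
  then have S_int: "integrable ?P S"
    unfolding single_target_def gibbs_measure_def
    using pos by (subst integrable_density) (simp_all add: divide_simps mult_ac)
  have dom: "\<forall>\<^sub>F n in sequentially. \<forall>x. real n * (\<Delta> n x)\<^sup>2 \<le> l ^ 4 * S x"
    using eventually_ge_at_top[of N]
  proof eventually_elim
    case (elim n)
    have "real n * (\<Delta> n x)\<^sup>2 = l ^ 4 * ((\<Delta> n x)\<^sup>2 / h n ^ 4)" for x
      using h_four[of n] N[OF elim] by simp
    then show ?case
      using mult_left_mono[OF S_upper[OF elim]] by simp
  qed

  have accept: "hmc_accept M V n X (hmc_proposal M V T (h n) n X) = min 1 (exp (- (\<Sum>i<n. \<Delta> n (X i))))" for n X
    by (simp add: hmc_accept_def hmc_proposal_def \<Delta>_def energy_error_def flip: sum_negf)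
  \<comment> \<open>The pointwise limit is \<open>l^2 * \<alpha>\<close> and the dominating function
    is \<open>l^4 * S\<close>; the factor \<open>l^2\<close> then leaves the square root.\<close>
  have "(\<lambda>n. \<integral>X. min 1 (exp (- (\<Sum>i<n. \<Delta> n (X i)))) \<partial>(\<Pi>\<^sub>M i\<in>{..<n}. ?P))
      \<longlonglongrightarrow> 2 * cdf std_normal_distribution (- sqrt (\<integral>x. (l\<^sup>2 * \<alpha> x)\<^sup>2 \<partial>?P) / 2)"
    by (rule metropolis_acceptance_limit[OF P _ rev conv _ dom])
       (use S_int in \<open>simp_all add: P_meas\<close>)
  moreover have "sqrt (\<integral>x. (l\<^sup>2 * \<alpha> x)\<^sup>2 \<partial>?P) = l\<^sup>2 * sqrt (\<integral>x. (\<alpha> x)\<^sup>2 \<partial>?P)"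
    unfolding power_mult_distrib integral_mult_right_zero real_sqrt_mult by (simp only: real_sqrt_abs abs_power2)
  ultimately show ?thesis
    unfolding h_def[symmetric] joint accept by simp
qed

end
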